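(* Suppose $\mathbb{P}$ and $\mathbb{Q}$ are distributions on $\mathbb{R}^N$ of the following form: to sample $Y\sim\mathbb{P}$ (or $Y\sim\mathbb{Q}$, respectively), first sample $X\in\mathbb{R}^N$ from an arbitrary prior $\mathbb{P}_X$ (or $\mathbb{Q}_X$, respectively), then sample $Z\sim\mathcal{N}(0,I_N)$ (independently of $X$), and set $Y=X+Z$. Define $r_\alpha\in\mathbb{R}$ for $\alpha\in\mathbb{N}^N$ recursively by $$r_\alpha=\mathbb{E}_{\mathbb{P}}[X^\alpha]-\sum_{0\le\beta\lneq\alpha}r_\beta\binom{\alpha}{\beta}\mathbb{E}_{\mathbb{Q}}[X^{\alpha-\beta}].$$ Then $$\mathsf{Adv}_{\le D}(\mathbb{P},\mathbb{Q})\le\sqrt{\sum_{\alpha\in\mathbb{N}^N,\ |\alpha|\le D}\frac{r_\alpha^2}{\alpha!}}.$$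
   Context: $\mathbb{N}=\{0,1,2,\dots\}$. For $\alpha,\beta\in\mathbb{N}^N$: $|\alpha|=\sum_i\alpha_i$, $\alpha!=\prod_i\alpha_i!$, $\binom{\alpha}{\beta}=\prod_i\binom{\alpha_i}{\beta_i}$, $X^\alpha=\prod_iX_i^{\alpha_i}$; $\beta\le\alpha$ means $\beta_i\le\alpha_i$ for all $i$, and $\beta\lneq\alpha$ means $\beta\le\alpha$ and $\beta\ne\alpha$. In particular $r_0=1$. It is understood that the moments of $X$ under both priors are finite, so that the $r_\alpha$ are defined. For an integer $D\ge0$, $$\mathsf{Adv}_{\le D}(\mathbb{P},\mathbb{Q}):=\sup_{f}\frac{\mathbb{E}_{\mathbb{P}}[f(Y)]}{\sqrt{\mathbb{E}_{\mathbb{Q}}[f(Y)^2]}},$$ where $f$ ranges over (nonzero) polynomials $\mathbb{R}^N\to\mathbb{R}$ of degree at most $D$. *)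

theory Defs
  imports "HOL-Probability.Probability"
begin

text \<open>
  Vectors in \<open>\<real>\<^sup>N\<close> are elements of \<^typ>\<open>real ^ 'n\<close> with \<open>N = CARD('n)\<close>; multi-indices in \<open>\<nat>\<^sup>N\<close> are
  functions \<^typ>\<open>'n \<Rightarrow> nat\<close>, so that \<open>\<beta> \<le> \<alpha>\<close> is the componentwise order and \<open>\<beta> < \<alpha>\<close> means
  \<open>\<beta> \<le> \<alpha>\<close> and \<open>\<beta> \<noteq> \<alpha>\<close>.
\<close>

definition mi_abs :: "('n::finite \<Rightarrow> nat) \<Rightarrow> nat" where
  "mi_abs \<alpha> = (\<Sum>i\<in>UNIV. \<alpha> i)"

definition mi_fact :: "('n::finite \<Rightarrow> nat) \<Rightarrow> nat" where
  "mi_fact \<alpha> = (\<Prod>i\<in>UNIV. fact (\<alpha> i))"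

definition mi_choose :: "('n::finite \<Rightarrow> nat) \<Rightarrow> ('n \<Rightarrow> nat) \<Rightarrow> nat" where
  "mi_choose \<alpha> \<beta> = (\<Prod>i\<in>UNIV. \<alpha> i choose \<beta> i)"

definition mi_diff :: "('n::finite \<Rightarrow> nat) \<Rightarrow> ('n \<Rightarrow> nat) \<Rightarrow> ('n \<Rightarrow> nat)" where
  "mi_diff \<alpha> \<beta> = (\<lambda>i. \<alpha> i - \<beta> i)"

definition monomial :: "('n::finite \<Rightarrow> nat) \<Rightarrow> real ^ 'n \<Rightarrow> real" where
  "monomial \<alpha> x = (\<Prod>i\<in>UNIV. (x $ i) ^ \<alpha> i)"

text \<open>The following two facts ensure that the sums over sets of multi-indices below are
  genuine finite sums.\<close>

lemma finite_mi_abs_le: "finite {\<alpha> :: 'n::finite \<Rightarrow> nat. mi_abs \<alpha> \<le> D}"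
proof (rule finite_subset)
  show "{\<alpha> :: 'n \<Rightarrow> nat. mi_abs \<alpha> \<le> D} \<subseteq> (\<Pi>\<^sub>E i\<in>UNIV. {..D})"
  proof
    fix \<alpha> :: "'n \<Rightarrow> nat"
    assume "\<alpha> \<in> {\<alpha>. mi_abs \<alpha> \<le> D}"
    moreover have "\<alpha> i \<le> mi_abs \<alpha>" for i
      unfolding mi_abs_def by (rule member_le_sum) auto
    ultimately show "\<alpha> \<in> (\<Pi>\<^sub>E i\<in>UNIV. {..D})"
      by (auto simp: PiE_UNIV_domain intro: order_trans)
  qed
  show "finite (\<Pi>\<^sub>E i\<in>(UNIV :: 'n set). {..D})"
    by (rule finite_PiE) auto
qed

lemma finite_mi_less: "finite {\<beta>. \<beta> < (\<alpha> :: 'n::finite \<Rightarrow> nat)}"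
  by (rule finite_subset[OF _ finite_mi_abs_le[of "mi_abs \<alpha>"]])
     (auto simp: mi_abs_def less_fun_def le_fun_def intro: sum_mono)

lemma mi_abs_strict_mono:
  fixes \<alpha> \<beta> :: "'n::finite \<Rightarrow> nat"
  assumes "\<beta> < \<alpha>"
  shows "mi_abs \<beta> < mi_abs \<alpha>"
  using assms unfolding mi_abs_def less_fun_def le_fun_def
  by (intro sum_strict_mono_ex1) (auto simp: not_le)

definition std_gaussian :: "(real ^ 'n::finite) measure" where
  "std_gaussian = density lborel (\<lambda>z. ennreal (\<Prod>i\<in>UNIV. std_normal_density (z $ i)))"

text \<open>The law of \<open>Y = X + Z\<close> where \<open>X\<close> has law \<open>M\<close> and \<open>Z\<close> is standard Gaussian,
  independent of \<open>X\<close>.\<close>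

definition additive_gaussian :: "(real ^ 'n::finite) measure \<Rightarrow> (real ^ 'n) measure" where
  "additive_gaussian M = distr (M \<Otimes>\<^sub>M std_gaussian) borel (\<lambda>(x, z). x + z)"

definition polynomials_deg_le :: "nat \<Rightarrow> (real ^ 'n::finite \<Rightarrow> real) set" where
  "polynomials_deg_le D = {f. \<exists>c. f = (\<lambda>y. \<Sum>\<alpha> | mi_abs \<alpha> \<le> D. c \<alpha> * monomial \<alpha> y)}"

text \<open>The supremum is taken in the extended reals, since it may be infinite. The quotient is also
  that of the extended reals, so a vanishing denominator does not turn the quotient into \<open>0\<close>
  when the numerator is nonzero.\<close>

definition Adv_le ::
  "nat \<Rightarrow> (real ^ 'n::finite) measure \<Rightarrow> (real ^ 'n) measure \<Rightarrow> ereal" where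
  "Adv_le D P Q =
     (SUP f \<in> polynomials_deg_le D - {\<lambda>_. 0}.
        ereal (\<integral>y. f y \<partial>P) / ereal (sqrt (\<integral>y. (f y)\<^sup>2 \<partial>Q)))"

function r_coeff ::
  "(real ^ 'n::finite) measure \<Rightarrow> (real ^ 'n) measure \<Rightarrow> ('n \<Rightarrow> nat) \<Rightarrow> real" where
  "r_coeff PX QX \<alpha> =
     (\<integral>x. monomial \<alpha> x \<partial>PX) -
     (\<Sum>\<beta> | \<beta> < \<alpha>. r_coeff PX QX \<beta> * real (mi_choose \<alpha> \<beta>) *
                       (\<integral>x. monomial (mi_diff \<alpha> \<beta>) x \<partial>QX))"
  by auto
termination
  by (relation "Wellfounded.measure (\<lambda>(_, _, \<alpha>). mi_abs \<alpha>)") (auto intro: mi_abs_strict_mono)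

text \<open>The recursion equation rewrites indefinitely.\<close>

declare r_coeff.simps [simp del]

end

theory Submission
  imports Defs "HOL-Computational_Algebra.Polynomial"
begin

text \<open>
  Let \<open>H\<^sub>\<alpha>\<close> be the monic Hermite polynomials. Stein's identity gives
  \<open>E [H\<^sub>\<alpha>(x + Z) H\<^sub>\<beta>(Z)] = \<beta>! (\<alpha> choose \<beta>) x\<^sup>\<alpha>\<^sup>-\<^sup>\<beta>\<close>, which contains both \<open>E [H\<^sub>\<alpha>(x + Z)] = x\<^sup>\<alpha>\<close> and
  orthogonality. Put \<open>L(z) = \<Sum> r\<^sub>\<beta> H\<^sub>\<beta>(z) / \<beta>!\<close>, summed over \<open>|\<beta>| \<le> D\<close>. By the recursion for \<open>r\<close>, the
  functionals \<open>E\<^sub>P [f(Y)]\<close> and \<open>E\<^sub>Q [f(X + Z) L(Z)]\<close> agree on every \<open>H\<^sub>\<alpha>\<close> with \<open>|\<alpha>| \<le> D\<close>, hence on all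
  polynomials of degree at most \<open>D\<close>. Since \<open>E [L(Z)\<^sup>2] = \<Sum> r\<^sub>\<beta>\<^sup>2 / \<beta>!\<close>, Cauchy--Schwarz gives the bound.
\<close>

subsection \<open>Hermite polynomials and Gaussian moments\<close>

text \<open>Taking the argument in \<open>real poly\<close> keeps derivatives, shifts and degrees
  algebraic; integration enters only through linearity and the moments.\<close>

definition gauss_exp :: "real poly \<Rightarrow> real" where
  "gauss_exp p = (\<integral>z. std_normal_density z * poly p z \<partial>lborel)"

lemma integrable_std_normal_poly: "integrable lborel (\<lambda>z. std_normal_density z * poly p z)"
proof -
  have "integrable lborel (\<lambda>z. \<Sum>i\<le>degree p. coeff p i * (std_normal_density z * z ^ i))"
    by (intro Bochner_Integration.integrable_sum integrable_mult_right integrable_std_normal_moment)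
  then show ?thesis
    by (simp add: poly_altdef sum_distrib_left algebra_simps)
qed

lemma gauss_exp_add: "gauss_exp (p + q) = gauss_exp p + gauss_exp q"
  unfolding gauss_exp_def poly_add distrib_left
  by (intro Bochner_Integration.integral_add integrable_std_normal_poly)

lemma gauss_exp_diff: "gauss_exp (p - q) = gauss_exp p - gauss_exp q"
  unfolding gauss_exp_def poly_diff right_diff_distrib
  by (intro Bochner_Integration.integral_diff integrable_std_normal_poly)

lemma gauss_exp_smult: "gauss_exp (smult c p) = c * gauss_exp p"
  unfolding gauss_exp_def poly_smult mult.left_commute[of _ c] by simp

lemma gauss_exp_0: "gauss_exp 0 = 0"
  by (simp add: gauss_exp_def)

lemma gauss_exp_1: "gauss_exp 1 = 1"
  using integral_std_normal_moment_even[of 0] by (simp add: gauss_exp_def)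

text \<open>Read off from the explicit moments, split by parity. For even \<open>n\<close> only odd
  moments occur, and they vanish; at \<open>n = 0\<close> the truncated \<open>n - 1\<close> is
  harmless because its factor is 0.\<close>

lemma gauss_exp_monom_Suc: "gauss_exp (monom 1 (Suc n)) = real n * gauss_exp (monom 1 (n - 1))"
proof (cases "even n")
  case True
  then obtain k where n: "n = 2 * k" by blast
  show ?thesis
  proof (cases k)
    case 0
    then show ?thesis
      using integral_std_normal_moment_odd[of 0] by (simp add: n gauss_exp_def poly_monom)
  next
    case (Suc j)
    then show ?thesis
      using integral_std_normal_moment_odd[of k] integral_std_normal_moment_odd[of j]
      by (simp add: n gauss_exp_def poly_monom)
  qed
next
  case False
  then obtain k where n: "n = 2 * k + 1" using oddE by blast
  \<comment> \<open>The ratio of the even moments of orders \<open>2 * k + 2\<close> and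
    \<open>2 * k\<close> is \<open>2 * k + 1\<close>, which is \<open>n\<close>.\<close>
  have "fact (2 * Suc k) / (2 ^ Suc k * fact (Suc k))
      = real (2 * k + 1) * (fact (2 * k) / (2 ^ k * fact k))"
    by (simp add: divide_simps)
  then show ?thesis
    using integral_std_normal_moment_even[of k] integral_std_normal_moment_even[of "Suc k"]
    by (simp add: n gauss_exp_def poly_monom del: fact_Suc power_Suc)
qed

text \<open>Stein's identity, with \<open>pCons 0\<close> as multiplication by the variable. Both
  sides are linear in \<open>p\<close>, and on monomials it is the moment recursion.\<close>

lemma gauss_exp_stein: "gauss_exp (pCons 0 p) = gauss_exp (pderiv p)"
proof -
  have monom: "gauss_exp (pCons 0 (monom c n)) = gauss_exp (pderiv (monom c n))" for c n
  proof -
    have "pCons 0 (monom c n) = smult c (monom 1 (Suc n))"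
      by (simp add: smult_monom monom_Suc)
    moreover have "pderiv (monom c n) = smult c (smult (real n) (monom 1 (n - 1)))"
      by (simp add: pderiv_monom smult_monom)
    ultimately show ?thesis
      by (simp only: gauss_exp_smult gauss_exp_monom_Suc)
  qed
  have add: "gauss_exp (pCons 0 (q + r)) = gauss_exp (pCons 0 q) + gauss_exp (pCons 0 r)" for q r
    using gauss_exp_add[of "pCons 0 q" "pCons 0 r"] by simp
  have "gauss_exp (pCons 0 (\<Sum>i\<in>A. monom (coeff p i) i))
      = gauss_exp (pderiv (\<Sum>i\<in>A. monom (coeff p i) i))" if "finite A" for A
    using that
  proof induction
    case (insert i A)
    then show ?case
      by (simp only: sum.insert[OF insert.hyps] add pderiv_add gauss_exp_add monom)
  qed (simp add: gauss_exp_0)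
  from this[of "{..degree p}"] show ?thesis
    by (simp add: poly_as_sum_of_monoms)
qed

text \<open>The probabilists' Hermite polynomials, generated by the raising operator z - d/dz, which
  by Stein's identity is adjoint to d/dz under the Gaussian weight.\<close>

fun hermite :: "nat \<Rightarrow> real poly" where
  "hermite 0 = 1"
| "hermite (Suc n) = pCons 0 (hermite n) - pderiv (hermite n)"

text \<open>The commutator of d/dz with the raising operator is the identity, so each raising step
  adds one more copy of \<open>hermite n\<close> to the derivative.\<close>

lemma pderiv_hermite: "pderiv (hermite n) = smult (real n) (hermite (n - 1))"
proof (induction n)
  case (Suc n)
  \<comment> \<open>By the induction hypothesis this is \<open>n\<close> times the raising operator
    applied to \<open>hermite (n - 1)\<close>; for \<open>n = 0\<close> both sides are 0.\<close>
  have "pCons 0 (pderiv (hermite n)) - pderiv (pderiv (hermite n)) = smult (real n) (hermite n)"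
    by (cases n) (use Suc in \<open>simp_all add: smult_diff_right pderiv_smult\<close>)
  then show ?case
    by (simp add: pderiv_diff pderiv_pCons smult_add_left algebra_simps)
qed (simp add: pderiv_1)

lemma degree_hermite_le: "degree (hermite n) \<le> n"
proof (induction n)
  case (Suc n)
  have "degree (pCons 0 (hermite n)) \<le> Suc n"
    using Suc by (simp add: degree_pCons_eq_if)
  moreover have "degree (pderiv (hermite n)) \<le> Suc n"
    using Suc by (simp add: degree_pderiv)
  ultimately show ?case
    by (simp add: degree_diff_le)
qed simp

lemma coeff_hermite_self: "coeff (hermite n) n = 1"
proof (induction n)
  case (Suc n)
  then show ?case
    using degree_hermite_le[of n] by (simp add: coeff_pderiv coeff_eq_0)
qed simp

text \<open>The change of basis is triangular: since \<open>hermite (Suc n)\<close> is monic,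
  subtracting \<open>coeff p (Suc n)\<close> times it lowers the degree bound by one.\<close>

lemma hermite_span:
  assumes "degree p \<le> n"
  shows "\<exists>d. p = (\<Sum>k\<le>n. smult (d k) (hermite k))"
  using assms
proof (induction n arbitrary: p)
  case 0
  then obtain c where "p = [:c:]" by (auto elim: degree_eq_zeroE)
  then show ?case by (intro exI[of _ "\<lambda>_. c"]) (simp add: one_pCons)
next
  case (Suc n)
  define q where "q = p - smult (coeff p (Suc n)) (hermite (Suc n))"
  have "degree q \<le> n"
  proof (rule degree_le, intro allI impI)
    fix i assume "n < i"
    then consider "i = Suc n" | "Suc n < i" by linarith
    then show "coeff q i = 0"
    proof cases
      case 1
      then show ?thesis
        using coeff_hermite_self[of "Suc n"] by (simp add: q_def del: hermite.simps)
    next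
      case 2
      then show ?thesis
        using Suc.prems degree_hermite_le[of "Suc n"]
        by (simp add: q_def coeff_eq_0 del: hermite.simps)
    qed
  qed
  then obtain d where d: "q = (\<Sum>k\<le>n. smult (d k) (hermite k))"
    using Suc.IH by blast
  have "p = (\<Sum>k\<le>Suc n. smult ((d(Suc n := coeff p (Suc n))) k) (hermite k))"
    using d by (simp add: q_def algebra_simps del: hermite.simps)
  then show ?case by blast
qed

text \<open>Stein's identity applied to \<open>p * hermite n\<close>; of the two product rule terms,
  \<open>p * pderiv (hermite n)\<close> cancels against the one in the raising operator.\<close>

lemma gauss_exp_mult_hermite_Suc:
  "gauss_exp (p * hermite (Suc n)) = gauss_exp (pderiv p * hermite n)"
proof -
  have "p * hermite (Suc n) = pCons 0 (p * hermite n) - p * pderiv (hermite n)"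
    by (simp add: algebra_simps)
  then show ?thesis
    by (simp only: gauss_exp_diff gauss_exp_stein pderiv_mult gauss_exp_add) (simp add: mult.commute)
qed

lemma pderiv_hermite_shift:
  "pderiv (hermite a \<circ>\<^sub>p [:x, 1:]) = smult (real a) (hermite (a - 1) \<circ>\<^sub>p [:x, 1:])"
  by (simp add: pderiv_pcompose pderiv_hermite pderiv_pCons pcompose_smult flip: one_pCons)

text \<open>With \<open>[:x, 1:]\<close> standing for x + z, the raising operator becomes x + z -
  d/dz. Its z and d/dz parts cancel in expectation, so each step contributes a factor
  \<open>x\<close>.\<close>

lemma gauss_exp_hermite_shift: "gauss_exp (hermite a \<circ>\<^sub>p [:x, 1:]) = x ^ a"
proof (induction a)
  case (Suc a)
  let ?q = "hermite a \<circ>\<^sub>p [:x, 1:]"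
  have "hermite (Suc a) \<circ>\<^sub>p [:x, 1:] = smult x ?q + pCons 0 ?q - pderiv ?q"
    by (simp add: pcompose_diff pcompose_pCons pderiv_pcompose pderiv_pCons flip: one_pCons)
  then show ?case
    by (simp only: gauss_exp_add gauss_exp_diff gauss_exp_smult gauss_exp_stein Suc.IH) simp
qed (simp add: gauss_exp_1 pcompose_1)

text \<open>Each step on \<open>b\<close> moves one raising operator off the second factor, where it
  differentiates the shifted one: \<open>a\<close> drops by one and comes out as a factor. For
  \<open>a < b\<close> a constant is eventually differentiated, matching the zero binomial.\<close>

lemma gauss_exp_hermite_shift_mult_hermite:
  "gauss_exp ((hermite a \<circ>\<^sub>p [:x, 1:]) * hermite b) = fact b * real (a choose b) * x ^ (a - b)"
proof (induction b arbitrary: a)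
  case 0
  then show ?case by (simp add: gauss_exp_hermite_shift)
next
  case (Suc b)
  show ?case
  proof (cases a)
    case 0
    then show ?thesis
      using gauss_exp_mult_hermite_Suc[of 1 b] by (simp add: pcompose_1 gauss_exp_0 del: hermite.simps(2))
  next
    case (Suc c)
    \<comment> \<open>The absorption identity for binomials turns the factor \<open>Suc c\<close>
      from differentiation into the next factorial and binomial.\<close>
    have "real (Suc b) * real (Suc c choose Suc b) = real (Suc c) * real (c choose b)"
      by (metis Suc_times_binomial of_nat_mult)
    then have "fact (Suc b) * real (Suc c choose Suc b) = real (Suc c) * (fact b * real (c choose b))"
      by (simp only: fact_Suc of_nat_mult) (metis mult.assoc mult.commute)
    with Suc show ?thesis
      by (simp add: gauss_exp_mult_hermite_Suc pderiv_hermite_shift gauss_exp_smult Suc.IH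
          del: hermite.simps(2) fact_Suc)
  qed
qed

subsection \<open>Integrability of polynomials\<close>

text \<open>Fubini for products of one-variable functions. Lebesgue measure on the vector type is
  the image of a product measure indexed by \<open>Basis\<close>, so coordinates are reindexed
  through the unit vectors.\<close>

lemma prod_vec_lborel:
  fixes h :: "'n::finite \<Rightarrow> real \<Rightarrow> real"
  assumes h: "\<And>i. integrable lborel (h i)"
  shows "integrable lborel (\<lambda>z :: real ^ 'n. \<Prod>i\<in>UNIV. h i (z $ i))"
    and "(\<integral>z. (\<Prod>i\<in>UNIV. h i (z $ i)) \<partial>(lborel :: (real ^ 'n) measure)) = (\<Prod>i\<in>UNIV. \<integral>t. h i t \<partial>lborel)"
proof -
  interpret product_sigma_finite "\<lambda>_ :: real ^ 'n. lborel :: real measure" ..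
  define e :: "'n \<Rightarrow> real ^ 'n" where "e i = axis i 1" for i
  define H where "H b = h (the_inv e b)" for b
  have inj: "inj e" by (auto simp: inj_on_def e_def axis_eq_axis)
  have Basis: "Basis = range e" by (auto simp: Basis_vec_def e_def)
  have H: "integrable lborel (H b)" for b by (simp add: H_def h)
  have [measurable]: "h i \<in> borel_measurable borel" for i
    using borel_measurable_integrable[OF h[of i]] by simp
  have He: "H (e i) = h i" for i by (simp add: H_def the_inv_f_f[OF inj])
  have coord: "(\<Sum>b\<in>Basis. x b *\<^sub>R b) $ i = x (e i)" for x i
  proof -
    have "(\<Sum>b\<in>Basis. x b *\<^sub>R b) $ i = (\<Sum>b\<in>Basis. x b *\<^sub>R b) \<bullet> e i"
      by (simp add: e_def cart_eq_inner_axis)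
    also have "\<dots> = x (e i)"
      by (rule inner_sum_left_Basis) (simp add: Basis)
    finally show ?thesis .
  qed
  have eq: "(\<Prod>i\<in>UNIV. h i ((\<Sum>b\<in>Basis. x b *\<^sub>R b) $ i)) = (\<Prod>b\<in>Basis. H b (x b))" for x
    unfolding coord by (simp add: Basis prod.reindex[OF inj] He)
  have integral_H: "(\<Prod>b\<in>Basis. integral\<^sup>L lborel (H b)) = (\<Prod>i\<in>UNIV. \<integral>t. h i t \<partial>lborel)"
    by (simp add: Basis prod.reindex[OF inj] He)
  show "integrable lborel (\<lambda>z :: real ^ 'n. \<Prod>i\<in>UNIV. h i (z $ i))"
    unfolding lborel_eq[where 'a = "real ^ 'n"]
    by (subst integrable_distr_eq) (simp_all add: eq product_integrable_prod H del: sum_component vector_scaleR_component)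
  show "(\<integral>z. (\<Prod>i\<in>UNIV. h i (z $ i)) \<partial>(lborel :: (real ^ 'n) measure)) = (\<Prod>i\<in>UNIV. \<integral>t. h i t \<partial>lborel)"
    unfolding lborel_eq[where 'a = "real ^ 'n"]
    by (subst integral_distr)
      (simp_all add: eq product_integral_prod H integral_H del: sum_component vector_scaleR_component)
qed

lemma sets_std_gaussian [measurable_cong]: "sets std_gaussian = sets borel"
  by (simp add: std_gaussian_def)

text \<open>The Gaussian density is a product over coordinates; absorbing one density factor into
  each polynomial factor reduces to one-dimensional integrals.\<close>

lemma std_gaussian_prod_poly:
  fixes p :: "'n::finite \<Rightarrow> real poly"
  shows "integrable std_gaussian (\<lambda>z. \<Prod>i\<in>UNIV. poly (p i) (z $ i))"
    and "(\<integral>z. (\<Prod>i\<in>UNIV. poly (p i) (z $ i)) \<partial>std_gaussian) = (\<Prod>i\<in>UNIV. gauss_exp (p i))"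
proof -
  have [measurable]: "(\<lambda>t. poly (p i) t) \<in> borel_measurable borel" for i
    by (intro borel_measurable_continuous_onI continuous_intros)
  have nn: "AE z in lborel. 0 \<le> (\<Prod>i\<in>UNIV. std_normal_density (z $ i))"
    by (intro AE_I2 prod_nonneg) auto
  note h = integrable_std_normal_poly
  show "integrable std_gaussian (\<lambda>z. \<Prod>i\<in>UNIV. poly (p i) (z $ i))"
    unfolding std_gaussian_def
    by (subst integrable_density[OF _ _ nn])
      (use prod_vec_lborel(1)[of "\<lambda>i t. std_normal_density t * poly (p i) t"] h
        in \<open>simp_all add: prod.distrib\<close>)
  show "(\<integral>z. (\<Prod>i\<in>UNIV. poly (p i) (z $ i)) \<partial>std_gaussian) = (\<Prod>i\<in>UNIV. gauss_exp (p i))"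
    unfolding std_gaussian_def
    by (subst integral_density[OF _ _ nn])
      (use prod_vec_lborel(2)[of "\<lambda>i t. std_normal_density t * poly (p i) t"] h
        in \<open>simp_all add: prod.distrib gauss_exp_def\<close>)
qed

section \<open>Polynomial growth and measures with finite moments\<close>

text \<open>Reduces integrability of polynomials to that of powers of 1 + norm. Since this base is
  at least 1, bounds with different exponents can be merged.\<close>

lemma real_polynomial_function_bound:
  assumes "real_polynomial_function p"
  shows "\<exists>C k. 0 \<le> C \<and> (\<forall>x. \<bar>p x\<bar> \<le> C * (1 + norm x) ^ k)"
  using assms
proof induction
  case (linear f)
  then obtain K where "0 \<le> K" "\<And>x. \<bar>f x\<bar> \<le> norm x * K"
    using bounded_linear.nonneg_bounded[OF linear] by auto
  then have "0 \<le> K \<and> (\<forall>x. \<bar>f x\<bar> \<le> K * (1 + norm x) ^ 1)"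
    by (simp add: algebra_simps add_increasing)
  then show ?case by blast
next
  case (const c)
  have "0 \<le> \<bar>c\<bar> \<and> (\<forall>x :: 'a. \<bar>c\<bar> \<le> \<bar>c\<bar> * (1 + norm x) ^ 0)" by simp
  then show ?case by blast
next
  case (add f g)
  then obtain C k D l where C: "0 \<le> C" "\<And>x. \<bar>f x\<bar> \<le> C * (1 + norm x) ^ k"
    and D: "0 \<le> D" "\<And>x. \<bar>g x\<bar> \<le> D * (1 + norm x) ^ l" by blast
  have "\<bar>f x + g x\<bar> \<le> (C + D) * (1 + norm x) ^ (k + l)" for x
  proof -
    have "C * (1 + norm x) ^ k \<le> C * (1 + norm x) ^ (k + l)"
      using C(1) by (intro mult_left_mono power_increasing) auto
    moreover have "D * (1 + norm x) ^ l \<le> D * (1 + norm x) ^ (k + l)"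
      using D(1) by (intro mult_left_mono power_increasing) auto
    ultimately show ?thesis
      using C(2)[of x] D(2)[of x] unfolding distrib_right by linarith
  qed
  with C(1) D(1) show ?case by (intro exI[of _ "C + D"] exI[of _ "k + l"]) auto
next
  case (mult f g)
  then obtain C k D l where C: "0 \<le> C" "\<And>x. \<bar>f x\<bar> \<le> C * (1 + norm x) ^ k"
    and D: "0 \<le> D" "\<And>x. \<bar>g x\<bar> \<le> D * (1 + norm x) ^ l" by blast
  have "\<bar>f x * g x\<bar> \<le> C * D * (1 + norm x) ^ (k + l)" for x
    using mult_mono[OF C(2)[of x] D(2)[of x]] C(1) by (simp add: abs_mult power_add algebra_simps)
  with C(1) D(1) show ?case by (intro exI[of _ "C * D"] exI[of _ "k + l"]) auto
qed

lemma borel_measurable_real_polynomial_function: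
  "real_polynomial_function p \<Longrightarrow> p \<in> borel_measurable borel"
  by (intro borel_measurable_continuous_onI continuous_on_polymonial_function)
    (simp add: real_polynomial_function_eq)

text \<open>Dominates norm powers by monomials, whose integrability is assumed; the even exponent
  \<open>2 * k\<close> removes absolute values. The coordinate of largest modulus controls the
  norm.\<close>

lemma one_plus_norm_power_le:
  fixes x :: "real ^ 'n::finite"
  shows "(1 + norm x) ^ k \<le> (1 + real CARD('n)) ^ k * (1 + (\<Sum>i\<in>UNIV. (x $ i) ^ (2 * k)))"
proof -
  have "Max (range (\<lambda>j. \<bar>x $ j\<bar>)) \<in> range (\<lambda>j. \<bar>x $ j\<bar>)" by (intro Max_in) auto
  then obtain i where "Max (range (\<lambda>j. \<bar>x $ j\<bar>)) = \<bar>x $ i\<bar>" by blast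
  then have i: "\<bar>x $ j\<bar> \<le> \<bar>x $ i\<bar>" for j
    using Max_ge[of "range (\<lambda>j. \<bar>x $ j\<bar>)" "\<bar>x $ j\<bar>"] by simp
  \<comment> \<open>Capping from below by 1 lets \<open>m\<close> absorb the summand 1 of
    \<open>1 + norm x\<close>, and makes \<open>m ^ k\<close> at most
    \<open>m ^ (2 * k)\<close>.\<close>
  define m where "m = max 1 \<bar>x $ i\<bar>"
  have "norm x \<le> (\<Sum>j\<in>UNIV. \<bar>x $ j\<bar>)" by (rule norm_le_l1_cart)
  also have "\<dots> \<le> real CARD('n) * m"
    using i by (intro sum_bounded_above) (simp add: m_def le_max_iff_disj)
  finally have "1 + norm x \<le> (1 + real CARD('n)) * m"
    by (simp add: algebra_simps add_mono m_def)
  then have "(1 + norm x) ^ k \<le> (1 + real CARD('n)) ^ k * m ^ k"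
    unfolding power_mult_distrib[symmetric] by (intro power_mono) auto
  moreover have "m ^ k \<le> 1 + (\<Sum>j\<in>UNIV. (x $ j) ^ (2 * k))"
  proof (cases "\<bar>x $ i\<bar> \<le> 1")
    case True
    then show ?thesis by (simp add: m_def max_def sum_nonneg)
  next
    case False
    then have "m ^ k \<le> \<bar>x $ i\<bar> ^ (2 * k)"
      unfolding m_def by (auto intro!: power_increasing)
    also have "\<dots> = (x $ i) ^ (2 * k)" by (simp add: power_even_abs)
    also have "\<dots> \<le> (\<Sum>j\<in>UNIV. (x $ j) ^ (2 * k))" by (rule member_le_sum) auto
    finally show ?thesis by simp
  qed
  ultimately show ?thesis
    by (meson mult_left_mono order_trans zero_le_power add_nonneg_nonneg zero_le_one of_nat_0_le_iff)
qed

text \<open>Holds for both priors and for the Gaussian noise, so that one set of integrability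
  lemmas serves all three.\<close>

locale moment_space = prob_space M for M :: "(real ^ 'n::finite) measure" +
  assumes sets_M [measurable_cong]: "sets M = sets borel"
    and integrable_monomial: "integrable M (monomial \<alpha>)"
begin

lemma integrable_norm_power: "integrable M (\<lambda>x. (1 + norm x) ^ k)"
proof (rule Bochner_Integration.integrable_bound)
  have "monomial (\<lambda>j. if j = i then 2 * k else 0) x = (x $ i) ^ (2 * k)" for i and x :: "real ^ 'n"
  proof -
    have "monomial (\<lambda>j. if j = i then 2 * k else 0) x
        = (\<Prod>j\<in>UNIV. if j = i then (x $ j) ^ (2 * k) else 1)"
      unfolding monomial_def by (intro prod.cong) auto
    then show ?thesis by simp
  qed
  then have "integrable M (\<lambda>x. (x $ i) ^ (2 * k))" for i
    using integrable_monomial[of "\<lambda>j. if j = i then 2 * k else 0"]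
    by (simp cong: Bochner_Integration.integrable_cong)
  then show "integrable M (\<lambda>x. (1 + real CARD('n)) ^ k * (1 + (\<Sum>i\<in>UNIV. (x $ i) ^ (2 * k))))"
    by simp
  show "AE x in M. norm ((1 + norm x) ^ k)
      \<le> norm ((1 + real CARD('n)) ^ k * (1 + (\<Sum>i\<in>UNIV. (x $ i) ^ (2 * k))))"
    using one_plus_norm_power_le[where 'n = 'n]
    by (intro AE_I2) (simp add: abs_mult sum_nonneg abs_of_nonneg)
qed measurable

end

lemma moment_space_std_gaussian: "moment_space (std_gaussian :: (real ^ 'n::finite) measure)"
proof -
  interpret prob_space "std_gaussian :: (real ^ 'n) measure"
  proof
    have "integrable (std_gaussian :: (real ^ 'n) measure) (\<lambda>_. 1 :: real)"
      and int: "(\<integral>_. 1 \<partial>(std_gaussian :: (real ^ 'n) measure)) = (1 :: real)"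
      using std_gaussian_prod_poly[of "\<lambda>_ :: 'n. 1"] by (simp_all add: gauss_exp_1)
    then have "emeasure std_gaussian (space (std_gaussian :: (real ^ 'n) measure)) \<noteq> \<infinity>"
      by (simp add: integrable_iff_bounded)
    then show "emeasure std_gaussian (space (std_gaussian :: (real ^ 'n) measure)) = 1"
      using int by (simp add: emeasure_eq_ennreal_measure)
  qed
  show "moment_space (std_gaussian :: (real ^ 'n) measure)"
  proof
    fix \<alpha> :: "'n \<Rightarrow> nat"
    show "integrable std_gaussian (monomial \<alpha>)"
      using std_gaussian_prod_poly(1)[of "\<lambda>i. monom 1 (\<alpha> i)"]
      by (simp add: poly_monom monomial_def[abs_def])
  qed (rule sets_std_gaussian)
qed

text \<open>The growth bound splits, because 1 + norm (x, y) is at most (1 + norm x) * (1 + norm y);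
  each factor has integrable powers under its own measure.\<close>

lemma integrable_pair_real_polynomial_function:
  fixes M N :: "(real ^ 'n::finite) measure"
  assumes "moment_space M" "moment_space N" and F: "real_polynomial_function F"
  shows "integrable (M \<Otimes>\<^sub>M N) F"
proof -
  interpret M: moment_space M by fact
  interpret N: moment_space N by fact
  interpret pair_sigma_finite M N ..
  obtain C k where C: "0 \<le> C" and le: "\<And>v. \<bar>F v\<bar> \<le> C * (1 + norm v) ^ k"
    using real_polynomial_function_bound[OF F] by blast
  have sets: "sets (M \<Otimes>\<^sub>M N) = sets borel"
    by (simp add: borel_prod[symmetric] M.sets_M N.sets_M cong: sets_pair_measure_cong)
  show ?thesis
  proof (rule Bochner_Integration.integrable_bound)
    show "integrable (M \<Otimes>\<^sub>M N) (\<lambda>v. C * ((1 + norm (fst v)) ^ k * (1 + norm (snd v)) ^ k))"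
    proof (intro integrable_mult_right Fubini_integrable)
      show "integrable M (\<lambda>x. \<integral>y. norm ((1 + norm (fst (x, y))) ^ k * (1 + norm (snd (x, y))) ^ k) \<partial>N)"
        using M.integrable_norm_power[of k] by (simp add: abs_mult)
      show "AE x in M. integrable N (\<lambda>y. (1 + norm (fst (x, y))) ^ k * (1 + norm (snd (x, y))) ^ k)"
        using N.integrable_norm_power[of k] by simp
    qed measurable
    show "F \<in> borel_measurable (M \<Otimes>\<^sub>M N)"
      using borel_measurable_real_polynomial_function[OF F] sets by (simp cong: measurable_cong_sets)
    have "\<bar>F (x, y)\<bar> \<le> C * ((1 + norm x) ^ k * (1 + norm y) ^ k)" for x y
    proof -
      have "1 + norm (x, y) \<le> (1 + norm x) * (1 + norm y)"
        using norm_Pair_le[of x y] mult_nonneg_nonneg[OF norm_ge_zero[of x] norm_ge_zero[of y]]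
        unfolding distrib_left distrib_right by linarith
      then have "(1 + norm (x, y)) ^ k \<le> (1 + norm x) ^ k * (1 + norm y) ^ k"
        unfolding power_mult_distrib[symmetric] by (intro power_mono) auto
      with C le[of "(x, y)"] show ?thesis by (meson mult_left_mono order_trans)
    qed
    then show "AE v in M \<Otimes>\<^sub>M N. norm (F v)
        \<le> norm (C * ((1 + norm (fst v)) ^ k * (1 + norm (snd v)) ^ k))"
      using C by (intro AE_I2) (auto simp: abs_mult split: prod.splits)
  qed
qed

lemma real_polynomial_function_poly:
  "real_polynomial_function g \<Longrightarrow> real_polynomial_function (\<lambda>x. poly p (g x))"
  by (induction p) auto

text \<open>The integral of the square of f - t g is a quadratic in t that is nonnegative for every
  t.\<close>

lemma Cauchy_Schwarz_integral:
  fixes f g :: "'a \<Rightarrow> real"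
  assumes ff: "integrable M (\<lambda>x. (f x)\<^sup>2)" and gg: "integrable M (\<lambda>x. (g x)\<^sup>2)"
    and fg: "integrable M (\<lambda>x. f x * g x)"
  shows "(\<integral>x. f x * g x \<partial>M)\<^sup>2 \<le> (\<integral>x. (f x)\<^sup>2 \<partial>M) * (\<integral>x. (g x)\<^sup>2 \<partial>M)"
proof -
  define a b c where "a = (\<integral>x. (f x)\<^sup>2 \<partial>M)" and "b = (\<integral>x. f x * g x \<partial>M)"
    and "c = (\<integral>x. (g x)\<^sup>2 \<partial>M)"
  have quad: "0 \<le> a - 2 * t * b + t\<^sup>2 * c" for t
  proof -
    have "0 \<le> (\<integral>x. (f x - t * g x)\<^sup>2 \<partial>M)" by simp
    also have "\<dots> = (\<integral>x. (f x)\<^sup>2 - (2 * t) * (f x * g x) + t\<^sup>2 * (g x)\<^sup>2 \<partial>M)"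
      by (intro Bochner_Integration.integral_cong) (auto simp: power2_eq_square algebra_simps)
    also have "\<dots> = a - 2 * t * b + t\<^sup>2 * c"
      using ff gg fg by (simp add: a_def b_def c_def)
    finally show ?thesis .
  qed
  have "0 \<le> c" by (simp add: c_def)
  then consider "c = 0" | "0 < c" by linarith
  then have "b\<^sup>2 \<le> a * c"
  proof cases
    case 1
    have "b = 0"
    proof (rule ccontr)
      assume "b \<noteq> 0"
      \<comment> \<open>For \<open>c = 0\<close> the quadratic is linear in t, and this t gives it
        the value -1.\<close>
      then show False using quad[of "(a + 1) / (2 * b)"] 1 by simp
    qed
    then show ?thesis using 1 by simp
  next
    case 2
    \<comment> \<open>The minimiser of the quadratic.\<close>
    then show ?thesis using quad[of "b / c"] by (simp add: power2_eq_square field_simps)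
  qed
  then show ?thesis by (simp add: a_def b_def c_def)
qed

subsection \<open>Multivariate Hermite polynomials\<close>

definition mi_hermite :: "('n::finite \<Rightarrow> nat) \<Rightarrow> real ^ 'n \<Rightarrow> real" where
  "mi_hermite \<alpha> x = (\<Prod>i\<in>UNIV. poly (hermite (\<alpha> i)) (x $ i))"

lemma real_polynomial_function_mi_hermite:
  assumes "bounded_linear g"
  shows "real_polynomial_function (\<lambda>v. mi_hermite \<alpha> (g v))"
  unfolding mi_hermite_def
  using bounded_linear_compose[OF bounded_linear_vec_nth assms]
  by (intro real_polynomial_function_prod real_polynomial_function_poly
      real_polynomial_function.intros(1)) auto

lemma real_polynomial_function_polynomials_deg_le:
  assumes "f \<in> polynomials_deg_le D" "bounded_linear g"
  shows "real_polynomial_function (\<lambda>v. f (g v))"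
proof -
  obtain c where f: "f = (\<lambda>y. \<Sum>\<alpha> | mi_abs \<alpha> \<le> D. c \<alpha> * monomial \<alpha> y)"
    using assms(1) by (auto simp: polynomials_deg_le_def)
  have "real_polynomial_function (\<lambda>v. monomial \<alpha> (g v))" for \<alpha>
    unfolding monomial_def
    using bounded_linear_compose[OF bounded_linear_vec_nth assms(2)]
    by (intro real_polynomial_function_prod real_polynomial_function_power
        real_polynomial_function.intros(1)) auto
  then show ?thesis
    unfolding f by (intro real_polynomial_function_sum finite_mi_abs_le
        real_polynomial_function.intros(4) real_polynomial_function.intros(2))
qed

text \<open>Expand each coordinate power in one-variable Hermite polynomials and distribute the
  product. Only indices \<beta> \<le> \<alpha> arise, so the degree bound is kept.\<close>

lemma monomial_eq_sum_mi_hermite: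
  fixes \<alpha> :: "'n::finite \<Rightarrow> nat"
  assumes "mi_abs \<alpha> \<le> D"
  shows "\<exists>e. \<forall>y. monomial \<alpha> y = (\<Sum>\<beta> | mi_abs \<beta> \<le> D. e \<beta> * mi_hermite \<beta> y)"
proof -
  have "\<exists>d. monom 1 m = (\<Sum>k\<le>m. smult (d k) (hermite k))" for m
    by (rule hermite_span) (rule degree_monom_le)
  then have "\<exists>d. \<forall>m. monom 1 m = (\<Sum>k\<le>m. smult (d m k) (hermite k))"
    by (intro choice allI)
  then obtain d where d: "\<And>m. monom 1 m = (\<Sum>k\<le>m. smult (d m k) (hermite k))" by blast
  define B where "B = PiE UNIV (\<lambda>i. {..\<alpha> i})"
  \<comment> \<open>Being zero off the box \<open>B\<close> of indices below \<alpha>, these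
    coefficients let the sum extend to all indices with
    \<open>mi_abs \<beta> \<le> D\<close>.\<close>
  define e where "e \<beta> = (if \<beta> \<in> B then \<Prod>i\<in>UNIV. d (\<alpha> i) (\<beta> i) else 0)" for \<beta>
  have B: "B \<subseteq> {\<beta>. mi_abs \<beta> \<le> D}"
    using assms by (auto simp: B_def mi_abs_def PiE_UNIV_domain intro: order_trans[OF sum_mono])
  have "monomial \<alpha> y = (\<Sum>\<beta> | mi_abs \<beta> \<le> D. e \<beta> * mi_hermite \<beta> y)" for y
  proof -
    have "y $ i ^ m = (\<Sum>k\<le>m. d m k * poly (hermite k) (y $ i))" for i m
      using arg_cong[OF d[of m], of "\<lambda>p. poly p (y $ i)"] by (simp add: poly_monom poly_sum)
    then have "monomial \<alpha> y = (\<Prod>i\<in>UNIV. \<Sum>k\<le>\<alpha> i. d (\<alpha> i) k * poly (hermite k) (y $ i))"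
      by (simp add: monomial_def)
    also have "\<dots> = (\<Sum>\<beta>\<in>B. \<Prod>i\<in>UNIV. d (\<alpha> i) (\<beta> i) * poly (hermite (\<beta> i)) (y $ i))"
      unfolding B_def by (rule prod_sum_PiE) auto
    also have "\<dots> = (\<Sum>\<beta>\<in>B. e \<beta> * mi_hermite \<beta> y)"
      by (intro sum.cong) (simp_all add: e_def mi_hermite_def prod.distrib)
    also have "\<dots> = (\<Sum>\<beta> | mi_abs \<beta> \<le> D. e \<beta> * mi_hermite \<beta> y)"
      by (intro sum.mono_neutral_left finite_mi_abs_le B) (auto simp: e_def)
    finally show ?thesis .
  qed
  then show ?thesis by blast
qed

lemma polynomials_deg_le_mi_hermite:
  fixes f :: "real ^ 'n::finite \<Rightarrow> real"
  assumes "f \<in> polynomials_deg_le D"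
  obtains c where "\<And>y. f y = (\<Sum>\<beta> | mi_abs \<beta> \<le> D. c \<beta> * mi_hermite \<beta> y)"
proof -
  obtain a where f: "f = (\<lambda>y. \<Sum>\<alpha> | mi_abs \<alpha> \<le> D. a \<alpha> * monomial \<alpha> y)"
    using assms by (auto simp: polynomials_deg_le_def)
  have "\<exists>e. \<forall>\<alpha> :: 'n \<Rightarrow> nat. mi_abs \<alpha> \<le> D \<longrightarrow>
      (\<forall>y. monomial \<alpha> y = (\<Sum>\<beta> | mi_abs \<beta> \<le> D. e \<alpha> \<beta> * mi_hermite \<beta> y))"
    using monomial_eq_sum_mi_hermite[where D = D] by (intro choice allI) blast
  then obtain e where e: "\<And>(\<alpha> :: 'n \<Rightarrow> nat) y. mi_abs \<alpha> \<le> D \<Longrightarrow>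
      monomial \<alpha> y = (\<Sum>\<beta> | mi_abs \<beta> \<le> D. e \<alpha> \<beta> * mi_hermite \<beta> y)"
    by blast
  have "f y = (\<Sum>\<beta> | mi_abs \<beta> \<le> D. (\<Sum>\<alpha> | mi_abs \<alpha> \<le> D. a \<alpha> * e \<alpha> \<beta>) * mi_hermite \<beta> y)" for y
  proof -
    have "f y = (\<Sum>\<alpha> | mi_abs \<alpha> \<le> D. \<Sum>\<beta> | mi_abs \<beta> \<le> D. a \<alpha> * e \<alpha> \<beta> * mi_hermite \<beta> y)"
      by (simp add: f e sum_distrib_left mult.assoc)
    then show ?thesis by (subst (asm) sum.swap) (simp add: sum_distrib_right)
  qed
  then show ?thesis by (rule that)
qed

section \<open>Integrals over the joint law of signal and noise\<close>

context moment_space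
begin

lemmas integrable_pair_gaussian =
  integrable_pair_real_polynomial_function[OF moment_space_axioms moment_space_std_gaussian]

lemma integral_pair_gaussian:
  fixes F :: "(real ^ 'n) \<times> (real ^ 'n) \<Rightarrow> real"
  assumes "real_polynomial_function F"
  shows "(\<integral>v. F v \<partial>(M \<Otimes>\<^sub>M std_gaussian)) = (\<integral>x. \<integral>z. F (x, z) \<partial>std_gaussian \<partial>M)"
proof -
  interpret G: moment_space "std_gaussian :: (real ^ 'n) measure" by (rule moment_space_std_gaussian)
  interpret pair_sigma_finite M "std_gaussian :: (real ^ 'n) measure" ..
  show ?thesis
    by (rule integral_fst'[symmetric]) (rule integrable_pair_gaussian[OF assms])
qed

lemma integral_pair_gaussian_sum:
  fixes F :: "'a \<Rightarrow> (real ^ 'n) \<times> (real ^ 'n) \<Rightarrow> real"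
  assumes "\<And>a. a \<in> A \<Longrightarrow> real_polynomial_function (F a)"
  shows "(\<integral>v. (\<Sum>a\<in>A. c a * F a v) \<partial>(M \<Otimes>\<^sub>M std_gaussian))
       = (\<Sum>a\<in>A. c a * (\<integral>v. F a v \<partial>(M \<Otimes>\<^sub>M std_gaussian)))"
proof -
  have "integrable (M \<Otimes>\<^sub>M std_gaussian) (\<lambda>v. c a * F a v)" if "a \<in> A" for a
    by (intro integrable_mult_right integrable_pair_gaussian assms that)
  then show ?thesis by (subst Bochner_Integration.integral_sum) auto
qed

text \<open>Used both for the second moment of L and for the pairing of f with L. Every product of
  terms is again polynomial, hence integrable.\<close>

lemma integral_pair_gaussian_sum_mult_sum:
  fixes F :: "'a \<Rightarrow> (real ^ 'n) \<times> (real ^ 'n) \<Rightarrow> real"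
    and G :: "'b \<Rightarrow> (real ^ 'n) \<times> (real ^ 'n) \<Rightarrow> real"
  assumes "finite B"
    and F: "\<And>a. a \<in> A \<Longrightarrow> real_polynomial_function (F a)"
    and G: "\<And>b. b \<in> B \<Longrightarrow> real_polynomial_function (G b)"
  shows "(\<integral>v. (\<Sum>a\<in>A. c a * F a v) * (\<Sum>b\<in>B. d b * G b v) \<partial>(M \<Otimes>\<^sub>M std_gaussian))
       = (\<Sum>a\<in>A. c a * (\<Sum>b\<in>B. d b * (\<integral>v. F a v * G b v \<partial>(M \<Otimes>\<^sub>M std_gaussian))))"
proof -
  have FG: "real_polynomial_function (\<lambda>v. F a v * G b v)" if "a \<in> A" "b \<in> B" for a b
    by (intro real_polynomial_function.intros(4) F G that)
  have "(\<integral>v. (\<Sum>a\<in>A. c a * F a v) * (\<Sum>b\<in>B. d b * G b v) \<partial>(M \<Otimes>\<^sub>M std_gaussian))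
      = (\<integral>v. (\<Sum>a\<in>A. c a * (\<Sum>b\<in>B. d b * (F a v * G b v))) \<partial>(M \<Otimes>\<^sub>M std_gaussian))"
    by (intro Bochner_Integration.integral_cong refl)
      (simp only: sum_product, simp only: sum_distrib_left mult_ac)
  also have "\<dots> = (\<Sum>a\<in>A. c a * (\<integral>v. (\<Sum>b\<in>B. d b * (F a v * G b v)) \<partial>(M \<Otimes>\<^sub>M std_gaussian)))"
    by (intro integral_pair_gaussian_sum real_polynomial_function_sum \<open>finite B\<close>
        real_polynomial_function.intros(4)[OF real_polynomial_function.intros(2)] FG)
  also have "\<dots> = (\<Sum>a\<in>A. c a * (\<Sum>b\<in>B. d b * (\<integral>v. F a v * G b v \<partial>(M \<Otimes>\<^sub>M std_gaussian))))"
    by (intro sum.cong refl arg_cong2[where f = "(*)"] integral_pair_gaussian_sum FG)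
  finally show ?thesis .
qed

lemma integral_additive_gaussian:
  fixes f :: "real ^ 'n \<Rightarrow> real"
  assumes [measurable]: "f \<in> borel_measurable borel"
  shows "(\<integral>y. f y \<partial>additive_gaussian M) = (\<integral>v. f (fst v + snd v) \<partial>(M \<Otimes>\<^sub>M std_gaussian))"
  unfolding additive_gaussian_def by (subst integral_distr) (simp_all add: case_prod_unfold)

text \<open>For fixed x the inner integral factors over coordinates into the one-dimensional
  pairings; then Fubini averages over x.\<close>

lemma mi_hermite_mixed_moment:
  "(\<integral>v. mi_hermite \<alpha> (fst v + snd v) * mi_hermite \<beta> (snd v) \<partial>(M \<Otimes>\<^sub>M std_gaussian))
   = real (mi_fact \<beta>) * real (mi_choose \<alpha> \<beta>) * (\<integral>x. monomial (mi_diff \<alpha> \<beta>) x \<partial>M)"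
proof -
  let ?g = "\<lambda>x i. (hermite (\<alpha> i) \<circ>\<^sub>p [:x $ i, 1:]) * hermite (\<beta> i)"
  have "(\<integral>z. mi_hermite \<alpha> (x + z) * mi_hermite \<beta> z \<partial>std_gaussian)
      = real (mi_fact \<beta>) * real (mi_choose \<alpha> \<beta>) * monomial (mi_diff \<alpha> \<beta>) x" for x :: "real ^ 'n"
  proof -
    have "(\<integral>z. mi_hermite \<alpha> (x + z) * mi_hermite \<beta> z \<partial>std_gaussian)
        = (\<integral>z. (\<Prod>i\<in>UNIV. poly (?g x i) (z $ i)) \<partial>std_gaussian)"
      by (simp add: mi_hermite_def prod.distrib poly_pcompose)
    also have "\<dots> = (\<Prod>i\<in>UNIV. gauss_exp (?g x i))"
      by (rule std_gaussian_prod_poly)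
    finally show ?thesis
      by (simp add: gauss_exp_hermite_shift_mult_hermite prod.distrib mi_fact_def mi_choose_def
          monomial_def mi_diff_def)
  qed
  moreover have "real_polynomial_function
      (\<lambda>v :: (real ^ 'n) \<times> (real ^ 'n). mi_hermite \<alpha> (fst v + snd v) * mi_hermite \<beta> (snd v))"
    by (intro real_polynomial_function.intros(4) real_polynomial_function_mi_hermite
        bounded_linear_add bounded_linear_fst bounded_linear_snd)
  ultimately show ?thesis
    by (simp add: integral_pair_gaussian)
qed

lemma mi_hermite_orthogonal:
  fixes \<alpha> \<beta> :: "'n \<Rightarrow> nat"
  shows
  "(\<integral>v. mi_hermite \<alpha> (snd v) * mi_hermite \<beta> (snd v) \<partial>(M \<Otimes>\<^sub>M std_gaussian))
   = (if \<alpha> = \<beta> then real (mi_fact \<beta>) else 0)"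
proof -
  \<comment> \<open>The shifted pairing at shift 0: \<open>0 ^ (a - b)\<close> vanishes for
    \<open>a > b\<close>, and the binomial for \<open>a < b\<close>.\<close>
  have "gauss_exp (hermite a * hermite b) = (if a = b then fact b else 0)" for a b
    using gauss_exp_hermite_shift_mult_hermite[of a 0 b]
    by (cases a b rule: linorder_cases) (simp_all add: binomial_eq_0)
  then have "(\<integral>z. mi_hermite \<alpha> z * mi_hermite \<beta> z \<partial>std_gaussian)
      = (\<Prod>i\<in>UNIV. if \<alpha> i = \<beta> i then fact (\<beta> i) else 0)"
    using std_gaussian_prod_poly(2)[of "\<lambda>i. hermite (\<alpha> i) * hermite (\<beta> i)"]
    by (simp add: mi_hermite_def prod.distrib)
  also have "\<dots> = (if \<alpha> = \<beta> then real (mi_fact \<beta>) else 0)"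
    by (auto simp: mi_fact_def fun_eq_iff)
  finally have "(\<integral>z. mi_hermite \<alpha> z * mi_hermite \<beta> z \<partial>std_gaussian)
      = (if \<alpha> = \<beta> then real (mi_fact \<beta>) else 0)" .
  moreover have "real_polynomial_function
      (\<lambda>v :: (real ^ 'n) \<times> (real ^ 'n). mi_hermite \<alpha> (snd v) * mi_hermite \<beta> (snd v))"
    by (intro real_polynomial_function.intros(4) real_polynomial_function_mi_hermite bounded_linear_snd)
  ultimately show ?thesis
    by (simp add: integral_pair_gaussian prob_space)
qed

lemma integral_mi_hermite_shift:
  "(\<integral>v. mi_hermite \<alpha> (fst v + snd v) \<partial>(M \<Otimes>\<^sub>M std_gaussian)) = (\<integral>x. monomial \<alpha> x \<partial>M)"
  using mi_hermite_mixed_moment[of \<alpha> "\<lambda>_. 0"]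
  by (simp add: mi_hermite_def mi_fact_def mi_choose_def mi_diff_def)

end

section \<open>The recursion for \<open>r_coeff\<close> and the advantage bound\<close>

text \<open>The defining recursion, solved for the moment under \<open>PX\<close>: binomials vanish
  unless \<beta> \<le> \<alpha>, and the term \<beta> = \<alpha> is
  \<open>r_coeff PX QX \<alpha>\<close> because \<open>QX\<close> has mass 1.\<close>

lemma sum_r_coeff_choose:
  fixes PX QX :: "(real ^ 'n::finite) measure"
  assumes "prob_space QX" "mi_abs \<alpha> \<le> D"
  shows "(\<Sum>\<beta> | mi_abs \<beta> \<le> D. r_coeff PX QX \<beta> * real (mi_choose \<alpha> \<beta>) *
            (\<integral>x. monomial (mi_diff \<alpha> \<beta>) x \<partial>QX)) = (\<integral>x. monomial \<alpha> x \<partial>PX)"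
    (is "(\<Sum>\<beta> | _. ?t \<beta>) = _")
proof -
  interpret prob_space QX by fact
  have "mi_choose \<alpha> \<beta> = 0" if "\<not> \<beta> \<le> \<alpha>" for \<beta>
    using that by (auto simp: mi_choose_def le_fun_def not_le)
  then have "(\<Sum>\<beta> | mi_abs \<beta> \<le> D. ?t \<beta>) = (\<Sum>\<beta> | \<beta> \<le> \<alpha>. ?t \<beta>)"
    using assms(2)
    by (intro sum.mono_neutral_right finite_mi_abs_le)
      (auto simp: mi_abs_def le_fun_def intro: order_trans[OF sum_mono])
  also have "{\<beta>. \<beta> \<le> \<alpha>} = insert \<alpha> {\<beta>. \<beta> < \<alpha>}" by (auto simp: le_less)
  also have "(\<Sum>\<beta>\<in>\<dots>. ?t \<beta>) = ?t \<alpha> + (\<Sum>\<beta> | \<beta> < \<alpha>. ?t \<beta>)"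
    by (rule sum.insert) (auto simp: finite_mi_less)
  also have "?t \<alpha> = r_coeff PX QX \<alpha>"
    by (simp add: mi_choose_def mi_diff_def monomial_def prob_space)
  finally have "(\<Sum>\<beta> | mi_abs \<beta> \<le> D. ?t \<beta>) = r_coeff PX QX \<alpha> + (\<Sum>\<beta> | \<beta> < \<alpha>. ?t \<beta>)" .
  moreover have "r_coeff PX QX \<alpha> = (\<integral>x. monomial \<alpha> x \<partial>PX) - (\<Sum>\<beta> | \<beta> < \<alpha>. ?t \<beta>)"
    by (rule r_coeff.simps)
  ultimately show ?thesis by linarith
qed

theorem proposition2p8:
  fixes PX QX :: "(real ^ 'n::finite) measure" and D :: nat
  assumes "prob_space PX" and "sets PX = sets borel"
    and "prob_space QX" and "sets QX = sets borel"
    and "\<And>\<alpha> :: 'n \<Rightarrow> nat. integrable PX (monomial \<alpha>)"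
    and "\<And>\<alpha> :: 'n \<Rightarrow> nat. integrable QX (monomial \<alpha>)"
  shows "Adv_le D (additive_gaussian PX) (additive_gaussian QX)
         \<le> ereal (sqrt (\<Sum>\<alpha> | mi_abs \<alpha> \<le> D. (r_coeff PX QX \<alpha>)\<^sup>2 / real (mi_fact \<alpha>)))"
proof -
  interpret PX: moment_space PX
    using assms by (intro moment_space.intro moment_space_axioms.intro)
  interpret QX: moment_space QX
    using assms by (intro moment_space.intro moment_space_axioms.intro)
  let ?V = "QX \<Otimes>\<^sub>M std_gaussian"
  let ?I = "{\<alpha> :: 'n \<Rightarrow> nat. mi_abs \<alpha> \<le> D}"
  define S where "S = (\<Sum>\<alpha>\<in>?I. (r_coeff PX QX \<alpha>)\<^sup>2 / real (mi_fact \<alpha>))"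
  \<comment> \<open>Dividing by the factorial cancels the factor \<open>mi_fact \<beta>\<close>
    produced by the Hermite pairings.\<close>
  define l where "l \<beta> = r_coeff PX QX \<beta> / real (mi_fact \<beta>)" for \<beta>
  define L where "L z = (\<Sum>\<beta>\<in>?I. l \<beta> * mi_hermite \<beta> z)" for z
  have fact_pos: "real (mi_fact \<beta>) > 0" for \<beta> :: "'n \<Rightarrow> nat"
    by (simp add: mi_fact_def prod_pos)
  have bl_add: "bounded_linear (\<lambda>v :: (real ^ 'n) \<times> (real ^ 'n). fst v + snd v)"
    by (intro bounded_linear_add bounded_linear_fst bounded_linear_snd)
  note rpf_intros = real_polynomial_function_sum real_polynomial_function.intros(2,4)
    real_polynomial_function_power real_polynomial_function_mi_hermite finite_mi_abs_le
    bl_add bounded_linear_snd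
  have L: "real_polynomial_function (\<lambda>v :: (real ^ 'n) \<times> (real ^ 'n). L (snd v))"
    unfolding L_def by (intro rpf_intros)

  \<comment> \<open>Orthogonality leaves the diagonal, where the square of r_\<beta> / \<beta>!
    times \<beta>! is the summand of \<open>S\<close>.\<close>
  have LL: "(\<integral>v. (L (snd v))\<^sup>2 \<partial>?V) = S"
  proof -
    have "(\<integral>v. (L (snd v))\<^sup>2 \<partial>?V) = (\<Sum>\<alpha>\<in>?I. l \<alpha> * (\<Sum>\<beta>\<in>?I. l \<beta> *
        (\<integral>v. mi_hermite \<alpha> (snd v) * mi_hermite \<beta> (snd v) \<partial>?V)))"
      unfolding L_def power2_eq_square
      by (intro QX.integral_pair_gaussian_sum_mult_sum rpf_intros)
    also have "\<dots> = (\<Sum>\<alpha>\<in>?I. (l \<alpha>)\<^sup>2 * real (mi_fact \<alpha>))"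
      by (intro sum.cong refl)
        (simp add: QX.mi_hermite_orthogonal if_distrib finite_mi_abs_le power2_eq_square cong: if_cong)
    also have "\<dots> = S"
      using fact_pos unfolding S_def l_def
      by (intro sum.cong) (auto simp: power2_eq_square)
    finally show ?thesis .
  qed

  \<comment> \<open>\<open>L\<close> plays the role of a likelihood ratio on low-degree polynomials.
    Both sides are linear in \<open>f\<close>, so Hermite products suffice; there the sum over
    \<beta> collapses by the recursion.\<close>
  have change: "(\<integral>v. f (fst v + snd v) * L (snd v) \<partial>?V) = (\<integral>y. f y \<partial>additive_gaussian PX)"
    if f: "f \<in> polynomials_deg_le D" for f
  proof -
    have mixed: "l \<beta> * (\<integral>v. mi_hermite \<alpha> (fst v + snd v) * mi_hermite \<beta> (snd v) \<partial>?V)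
        = r_coeff PX QX \<beta> * real (mi_choose \<alpha> \<beta>) * (\<integral>x. monomial (mi_diff \<alpha> \<beta>) x \<partial>QX)" for \<alpha> \<beta>
      using fact_pos[of \<beta>] by (simp add: QX.mi_hermite_mixed_moment l_def)
    obtain c where c: "\<And>y. f y = (\<Sum>\<alpha>\<in>?I. c \<alpha> * mi_hermite \<alpha> y)"
      using polynomials_deg_le_mi_hermite[OF f] by blast
    have "(\<integral>v. f (fst v + snd v) * L (snd v) \<partial>?V) = (\<Sum>\<alpha>\<in>?I. c \<alpha> * (\<Sum>\<beta>\<in>?I. l \<beta> *
        (\<integral>v. mi_hermite \<alpha> (fst v + snd v) * mi_hermite \<beta> (snd v) \<partial>?V)))"
      unfolding L_def c by (intro QX.integral_pair_gaussian_sum_mult_sum rpf_intros)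
    also have "\<dots> = (\<Sum>\<alpha>\<in>?I. c \<alpha> * (\<Sum>\<beta>\<in>?I. r_coeff PX QX \<beta> * real (mi_choose \<alpha> \<beta>) *
            (\<integral>x. monomial (mi_diff \<alpha> \<beta>) x \<partial>QX)))"
      by (simp only: mixed)
    also have "\<dots> = (\<Sum>\<alpha>\<in>?I. c \<alpha> * (\<integral>v. mi_hermite \<alpha> (fst v + snd v) \<partial>(PX \<Otimes>\<^sub>M std_gaussian)))"
      using assms(3)
      by (intro sum.cong) (simp_all add: sum_r_coeff_choose PX.integral_mi_hermite_shift)
    also have "\<dots> = (\<integral>v. f (fst v + snd v) \<partial>(PX \<Otimes>\<^sub>M std_gaussian))"
      unfolding c by (intro PX.integral_pair_gaussian_sum[symmetric] rpf_intros)
    also have "\<dots> = (\<integral>y. f y \<partial>additive_gaussian PX)"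
      using real_polynomial_function_polynomials_deg_le[OF f bounded_linear_ident]
      by (intro PX.integral_additive_gaussian[symmetric] borel_measurable_real_polynomial_function)
    finally show ?thesis .
  qed

  \<comment> \<open>Cauchy--Schwarz is applied on the joint law \<open>?V\<close>, since
    \<open>L\<close> is a function of the noise and not of the observation.\<close>
  have bound: "\<bar>\<integral>y. f y \<partial>additive_gaussian PX\<bar>
      \<le> sqrt (\<integral>y. (f y)\<^sup>2 \<partial>additive_gaussian QX) * sqrt S"
    if f: "f \<in> polynomials_deg_le D" for f
  proof -
    have F: "real_polynomial_function (\<lambda>v :: (real ^ 'n) \<times> (real ^ 'n). f (fst v + snd v))"
      by (rule real_polynomial_function_polynomials_deg_le[OF f bl_add])
    have f2: "(\<lambda>y. (f y)\<^sup>2) \<in> borel_measurable borel"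
      using real_polynomial_function_polynomials_deg_le[OF f bounded_linear_ident]
      by (intro borel_measurable_real_polynomial_function real_polynomial_function_power)
    have "(\<integral>v. f (fst v + snd v) * L (snd v) \<partial>?V)\<^sup>2
        \<le> (\<integral>v. (f (fst v + snd v))\<^sup>2 \<partial>?V) * (\<integral>v. (L (snd v))\<^sup>2 \<partial>?V)"
      by (intro Cauchy_Schwarz_integral QX.integrable_pair_gaussian rpf_intros F L)
    then have "(\<integral>y. f y \<partial>additive_gaussian PX)\<^sup>2
        \<le> (\<integral>y. (f y)\<^sup>2 \<partial>additive_gaussian QX) * S"
      by (simp only: change[OF f] LL QX.integral_additive_gaussian[OF f2])
    then show ?thesis
      by (metis real_sqrt_abs real_sqrt_le_mono real_sqrt_mult)
  qed

  have "ereal (\<integral>y. f y \<partial>additive_gaussian PX) / ereal (sqrt (\<integral>y. (f y)\<^sup>2 \<partial>additive_gaussian QX))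
      \<le> ereal (sqrt S)" if f: "f \<in> polynomials_deg_le D" for f
  proof -
    define a b where "a = (\<integral>y. f y \<partial>additive_gaussian PX)"
      and "b = sqrt (\<integral>y. (f y)\<^sup>2 \<partial>additive_gaussian QX)"
    have ab: "\<bar>a\<bar> \<le> b * sqrt S" using bound[OF f] by (simp add: a_def b_def)
    have "0 \<le> b" by (simp add: b_def)
    then consider "b = 0" | "0 < b" by linarith
    then have "ereal a / ereal b \<le> ereal (sqrt S)"
    proof cases
      \<comment> \<open>The bound forces \<open>a = 0\<close>, and in the extended reals 0 / 0 is 0,
        so it remains to see that \<open>S\<close> is nonnegative.\<close>
      case 1
      have "0 \<le> S" using LL by (metis integral_nonneg_AE AE_I2 zero_le_power2)
      with 1 ab show ?thesis by simp
    next
      case 2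
      with ab show ?thesis by (simp add: divide_le_eq mult.commute)
    qed
    then show ?thesis by (simp add: a_def b_def)
  qed
  then show ?thesis
    unfolding Adv_le_def S_def by (intro SUP_least) blast
qed

end
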